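(* There exist a Poisson manifold $(M,\pi)$ and a cotangent loop $a\in C_\pi^{S^1}$ on it such that the tangent cone $T_aC_\pi^{S^1}$ at $a$ of the set $C_\pi^{S^1}$ of cotangent loops is not a vector space (i.e. is not a vector subspace of the space of smooth sections of $a^*T(T^*M)$ over $S^1$).
   Context: For a Poisson manifold $(M,\pi)$, with $\pi^\#:T^*M\to TM$ the bundle map associated with the bivector $\pi$, a cotangent loop is a smooth map $a:S^1\to T^*M$ with base path $q:S^1\to M$ (the projection of $a$ to $M$) satisfying $\frac{dq(t)}{dt}=\pi^\#_{q(t)}(a(t))$ for all $t$. $C_\pi^{S^1}$ is the set of cotangent loops. The tangent cone $T_aC_\pi^{S^1}$ at $a\in C_\pi^{S^1}$ is the set of all $\frac{d}{d\epsilon}\big|_{\epsilon=0}a_\epsilon$, where $(a_\epsilon)$ is a one-parameter family of elements of $C_\pi^{S^1}$, defined for $\epsilon$ in a neighborhood of $0\in\mathbb{R}$, such that $a_\epsilon(t)$ is smooth in $(t,\epsilon)$ and $a_0=a$. These derivatives are smooth sections of $a^*T(T^*M)$ over $S^1$. *)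

theory Defs
  imports "HOL-Analysis.Analysis" "HOL-Library.Function_Algebras"
begin

section \<open>Smooth functions on open subsets of \<open>\<real>\<^sup>n\<close>\<close>

text \<open>
  The library's \<^const>\<open>Euclidean_space\<close> \<open>n\<close> is the subspace of \<^typ>\<open>nat \<Rightarrow> real\<close> of the
  vectors whose coordinates with index \<open>\<ge> n\<close> vanish, so that the dimension \<open>n\<close> can be quantified
  over.
\<close>

definition partial :: "nat \<Rightarrow> ((nat \<Rightarrow> real) \<Rightarrow> real) \<Rightarrow> (nat \<Rightarrow> real) \<Rightarrow> real" where
  "partial i f x = deriv (\<lambda>s. f (x(i := s))) (x i)"

primrec partials :: "nat list \<Rightarrow> ((nat \<Rightarrow> real) \<Rightarrow> real) \<Rightarrow> (nat \<Rightarrow> real) \<Rightarrow> real" where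
  "partials [] f = f"
| "partials (i # is) f = partial i (partials is f)"

text \<open>
  For \<open>U\<close> open in \<open>\<real>\<^sup>n\<close>: all iterated partial derivatives of \<open>f\<close> exist and are continuous on \<open>U\<close>.
\<close>

definition smooth_on :: "nat \<Rightarrow> (nat \<Rightarrow> real) set \<Rightarrow> ((nat \<Rightarrow> real) \<Rightarrow> real) \<Rightarrow> bool" where
  "smooth_on n U f \<longleftrightarrow>
    (\<forall>is. set is \<subseteq> {..<n} \<longrightarrow>
       continuous_map (subtopology (Euclidean_space n) U) euclideanreal (partials is f) \<and>
       (\<forall>x\<in>U. \<forall>i<n. (\<lambda>s. partials is f (x(i := s))) field_differentiable at (x i)))"


section \<open>Smooth manifolds\<close>

type_synonym 'a chart = "'a set \<times> ('a \<Rightarrow> nat \<Rightarrow> real)"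

record 'a manifold =
  mdim :: nat
  mtop :: "'a topology"
  matlas :: "'a chart set"

text \<open>The atlas need not be maximal; it determines the smooth structure.\<close>

definition smooth_manifold :: "'a manifold \<Rightarrow> bool" where
  "smooth_manifold M \<longleftrightarrow>
    Hausdorff_space (mtop M) \<and> second_countable (mtop M) \<and>
    (\<Union>(U, \<phi>)\<in>matlas M. U) = topspace (mtop M) \<and>
    (\<forall>(U, \<phi>)\<in>matlas M.
       openin (mtop M) U \<and> openin (Euclidean_space (mdim M)) (\<phi> ` U) \<and>
       homeomorphic_map (subtopology (mtop M) U)
         (subtopology (Euclidean_space (mdim M)) (\<phi> ` U)) \<phi>) \<and>
    (\<forall>(U, \<phi>)\<in>matlas M. \<forall>(V, \<psi>)\<in>matlas M. \<forall>i<mdim M.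
       smooth_on (mdim M) (\<phi> ` (U \<inter> V)) (\<lambda>x. \<psi> (inv_into U \<phi> x) i))"

text \<open>
  Functions on a manifold are total functions on the type \<^typ>\<open>'a\<close>; their values off
  \<open>topspace (mtop M)\<close> are arbitrary and irrelevant. In particular, the Leibniz rule below makes
  tangent vectors insensitive to them.
\<close>

definition smooth_functions :: "'a manifold \<Rightarrow> ('a \<Rightarrow> real) set" where
  "smooth_functions M =
    {f. \<forall>(U, \<phi>)\<in>matlas M. smooth_on (mdim M) (\<phi> ` U) (\<lambda>x. f (inv_into U \<phi> x))}"

definition smooth_map_into ::
    "nat \<Rightarrow> (nat \<Rightarrow> real) set \<Rightarrow> 'a manifold \<Rightarrow> ((nat \<Rightarrow> real) \<Rightarrow> 'a) \<Rightarrow> bool" where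
  "smooth_map_into m V N c \<longleftrightarrow>
    (\<forall>x\<in>V. \<exists>W. \<exists>(U, \<phi>)\<in>matlas N.
       openin (Euclidean_space m) W \<and> x \<in> W \<and> W \<subseteq> V \<and> c ` W \<subseteq> U \<and>
       (\<forall>i<mdim N. smooth_on m W (\<lambda>y. \<phi> (c y) i)))"

text \<open>
  Tangent vectors at \<open>p\<close> are the derivations at \<open>p\<close> of the algebra of smooth functions, extended by
  \<open>0\<close> to non-smooth functions. Thus the linear structure of a tangent space is the pointwise one.
\<close>

type_synonym 'a tvec = "('a \<Rightarrow> real) \<Rightarrow> real"

definition tangent_space :: "'a manifold \<Rightarrow> 'a \<Rightarrow> 'a tvec set" where
  "tangent_space M p =
    {v. (\<forall>f\<in>smooth_functions M. \<forall>g\<in>smooth_functions M.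
           v (\<lambda>x. f x + g x) = v f + v g \<and>
           v (\<lambda>x. f x * g x) = f p * v g + g p * v f) \<and>
        (\<forall>f\<in>smooth_functions M. \<forall>r. v (\<lambda>x. r * f x) = r * v f) \<and>
        (\<forall>f. f \<notin> smooth_functions M \<longrightarrow> v f = 0)}"

definition velocity :: "'a manifold \<Rightarrow> (real \<Rightarrow> 'a) \<Rightarrow> real \<Rightarrow> 'a tvec" where
  "velocity M \<gamma> t = (\<lambda>f. if f \<in> smooth_functions M then deriv (\<lambda>s. f (\<gamma> s)) t else 0)"

definition coord_tvec :: "'a manifold \<Rightarrow> 'a chart \<Rightarrow> nat \<Rightarrow> 'a \<Rightarrow> 'a tvec" where
  "coord_tvec M = (\<lambda>(U, \<phi>) i p f.
    if f \<in> smooth_functions M then partial i (\<lambda>x. f (inv_into U \<phi> x)) (\<phi> p) else 0)"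


section \<open>The cotangent bundle\<close>

type_synonym 'a covec = "'a tvec \<Rightarrow> real"

text \<open>Linear functionals on the tangent space, extended by \<open>0\<close> off the tangent space.\<close>

definition cotangent_space :: "'a manifold \<Rightarrow> 'a \<Rightarrow> 'a covec set" where
  "cotangent_space M p =
    {\<alpha>. (\<forall>v\<in>tangent_space M p. \<forall>w\<in>tangent_space M p. \<alpha> (\<lambda>f. v f + w f) = \<alpha> v + \<alpha> w) \<and>
        (\<forall>v\<in>tangent_space M p. \<forall>r. \<alpha> (\<lambda>f. r * v f) = r * \<alpha> v) \<and>
        (\<forall>v. v \<notin> tangent_space M p \<longrightarrow> \<alpha> v = 0)}"

definition differential :: "'a manifold \<Rightarrow> ('a \<Rightarrow> real) \<Rightarrow> 'a \<Rightarrow> 'a covec" where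
  "differential M f p = (\<lambda>v. if v \<in> tangent_space M p then v f else 0)"

definition cotangent_set :: "'a manifold \<Rightarrow> 'a set \<Rightarrow> ('a \<times> 'a covec) set" where
  "cotangent_set M U = (SIGMA p:U. cotangent_space M p)"

text \<open>
  The bundle chart \<open>(p, \<alpha>) \<mapsto> (x\<^sub>1, \<dots>, x\<^sub>n, \<xi>\<^sub>1, \<dots>, \<xi>\<^sub>n)\<close>, with \<open>\<alpha> = \<Sum>\<^sub>i \<xi>\<^sub>i dx\<^sub>i\<close> at \<open>p\<close>.
\<close>

definition cotangent_chart :: "'a manifold \<Rightarrow> 'a chart \<Rightarrow> ('a \<times> 'a covec) chart" where
  "cotangent_chart M = (\<lambda>(U, \<phi>).
    (cotangent_set M U,
     \<lambda>(p, \<alpha>) i. if i < mdim M then \<phi> p i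
                else if i < 2 * mdim M then \<alpha> (coord_tvec M (U, \<phi>) (i - mdim M) p)
                else 0))"

definition cotangent_bundle :: "'a manifold \<Rightarrow> ('a \<times> 'a covec) manifold" where
  "cotangent_bundle M =
    \<lparr>mdim = 2 * mdim M,
     mtop = topology (\<lambda>W. W \<subseteq> cotangent_set M (topspace (mtop M)) \<and>
       (\<forall>(U, \<Phi>)\<in>cotangent_chart M ` matlas M. openin (Euclidean_space (2 * mdim M)) (\<Phi> ` (U \<inter> W)))),
     matlas = cotangent_chart M ` matlas M\<rparr>"


section \<open>Poisson manifolds\<close>

type_synonym 'a bivector = "'a \<Rightarrow> 'a covec \<Rightarrow> 'a covec \<Rightarrow> real"

definition poisson_bracket ::
    "'a manifold \<Rightarrow> 'a bivector \<Rightarrow> ('a \<Rightarrow> real) \<Rightarrow> ('a \<Rightarrow> real) \<Rightarrow> 'a \<Rightarrow> real" where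
  "poisson_bracket M \<pi> f g = (\<lambda>p. \<pi> p (differential M f p) (differential M g p))"

text \<open>
  A bivector field is smooth iff \<open>\<pi>(df, dg)\<close> is smooth for all smooth \<open>f\<close> and \<open>g\<close>.
\<close>

definition bivector_field :: "'a manifold \<Rightarrow> 'a bivector \<Rightarrow> bool" where
  "bivector_field M \<pi> \<longleftrightarrow>
    (\<forall>p\<in>topspace (mtop M).
       \<forall>\<alpha>\<in>cotangent_space M p. \<forall>\<beta>\<in>cotangent_space M p.
         \<pi> p \<alpha> \<beta> = - \<pi> p \<beta> \<alpha> \<and>
         (\<forall>r. \<pi> p (\<lambda>v. r * \<alpha> v) \<beta> = r * \<pi> p \<alpha> \<beta>) \<and>
         (\<forall>\<gamma>\<in>cotangent_space M p. \<pi> p (\<lambda>v. \<alpha> v + \<gamma> v) \<beta> = \<pi> p \<alpha> \<beta> + \<pi> p \<gamma> \<beta>)) \<and>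
    (\<forall>f\<in>smooth_functions M. \<forall>g\<in>smooth_functions M. poisson_bracket M \<pi> f g \<in> smooth_functions M)"

definition poisson_manifold :: "'a manifold \<Rightarrow> 'a bivector \<Rightarrow> bool" where
  "poisson_manifold M \<pi> \<longleftrightarrow>
    smooth_manifold M \<and> bivector_field M \<pi> \<and>
    (\<forall>f\<in>smooth_functions M. \<forall>g\<in>smooth_functions M. \<forall>h\<in>smooth_functions M.
       \<forall>p\<in>topspace (mtop M).
         poisson_bracket M \<pi> f (poisson_bracket M \<pi> g h) p +
         poisson_bracket M \<pi> g (poisson_bracket M \<pi> h f) p +
         poisson_bracket M \<pi> h (poisson_bracket M \<pi> f g) p = 0)"

text \<open>Sign convention: \<open>\<langle>\<beta>, \<pi>\<^sup>#(\<alpha>)\<rangle> = \<pi>(\<alpha>, \<beta>)\<close>.\<close>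

definition sharp :: "'a manifold \<Rightarrow> 'a bivector \<Rightarrow> 'a \<times> 'a covec \<Rightarrow> 'a tvec" where
  "sharp M \<pi> = (\<lambda>(p, \<alpha>) f.
    if f \<in> smooth_functions M then \<pi> p \<alpha> (differential M f p) else 0)"


section \<open>Cotangent loops and the tangent cone\<close>

text \<open>Maps on the circle \<open>S\<^sup>1 = \<real>/\<int>\<close> are \<open>1\<close>-periodic maps on \<open>\<real>\<close>.\<close>

definition cotangent_loops :: "'a manifold \<Rightarrow> 'a bivector \<Rightarrow> (real \<Rightarrow> 'a \<times> 'a covec) set" where
  "cotangent_loops M \<pi> =
    {a. (\<forall>t. a (t + 1) = a t) \<and>
        smooth_map_into 1 (topspace (Euclidean_space 1)) (cotangent_bundle M) (\<lambda>x. a (x 0)) \<and>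
        (\<forall>t. velocity M (\<lambda>s. fst (a s)) t = sharp M \<pi> (a t))}"

text \<open>
  The family \<open>c \<epsilon> t\<close> is smooth in \<open>(t, \<epsilon>) = (x 0, x 1)\<close>. An element of the cone assigns to \<open>t\<close> a
  tangent vector to \<open>T\<^sup>*M\<close> at \<open>a t\<close>.
\<close>

definition tangent_cone ::
    "'a manifold \<Rightarrow> 'a bivector \<Rightarrow> (real \<Rightarrow> 'a \<times> 'a covec) \<Rightarrow> (real \<Rightarrow> ('a \<times> 'a covec) tvec) set" where
  "tangent_cone M \<pi> a =
    {\<sigma>. \<exists>I c. open I \<and> 0 \<in> I \<and> (\<forall>\<epsilon>\<in>I. c \<epsilon> \<in> cotangent_loops M \<pi>) \<and> c 0 = a \<and>
         smooth_map_into 2 {x \<in> topspace (Euclidean_space 2). x 1 \<in> I} (cotangent_bundle M)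
           (\<lambda>x. c (x 1) (x 0)) \<and>
         \<sigma> = (\<lambda>t. velocity (cotangent_bundle M) (\<lambda>\<epsilon>. c \<epsilon> t) 0)}"

text \<open>
  Sections of \<open>a\<^sup>*T(T\<^sup>*M)\<close> are added and scaled pointwise, so a set of such sections is a vector
  subspace of the space of smooth sections only if it is a subspace of the following space of all
  functions.
\<close>

abbreviation is_vector_subspace :: "(real \<Rightarrow> 'b tvec) set \<Rightarrow> bool" where
  "is_vector_subspace \<equiv> module.subspace (\<lambda>(r::real) \<sigma> t f. r * \<sigma> t f)"

end

theory Submission
  imports Defs
begin

text \<open>
  The example is the plane with the Poisson structure \<open>\<pi> = (x y)\<^sup>2 \<partial>\<^sub>x \<and> \<partial>\<^sub>y\<close>, which vanishes
  exactly on the two coordinate axes, and the loop that is constantly the covector \<open>dy\<close> at the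
  origin.

  A cotangent loop with base path \<open>(x, y)\<close> and covector \<open>\<xi> dx + \<eta> dy\<close> satisfies
  \<open>x' = - (x y)\<^sup>2 \<eta>\<close>. If the loop is close to the constant loop \<open>dy\<close>, then \<open>\<eta> > 0\<close> everywhere, so
  \<open>x\<close> is nonincreasing. Being periodic it is constant, and then \<open>x y = 0\<close>: all nearby loops lie
  over the axes (\<open>loop_on_cross\<close>). In a smooth family of loops through the constant one, closeness
  is uniform in time by compactness of the circle (\<open>bundle_family_positive\<close>), and the equation
  \<open>x y = 0\<close> forces \<open>X Y = 0\<close> for the base components \<open>X\<close>, \<open>Y\<close> of the derivative of the family
  (\<open>cone_in_cross\<close>).

  Conversely, at each point of the axes \<open>\<pi>\<close> vanishes and \<open>dy\<close> is a constant cotangent loop, so moving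
  the base point along either axis gives elements of the tangent cone with \<open>(X, Y) = (1, 0)\<close> and
  \<open>(X, Y) = (0, 1)\<close> (\<open>ray_section_in_cone\<close>). Their sum has \<open>X Y = 1\<close> and is not in the cone.

  Everything else serves to establish that \<open>\<pi>\<close> is a Poisson structure (\<open>poisson_manifold_planar\<close>).
  This needs the algebra of smooth functions (\<open>smooth_coinduct\<close>), and, for the Jacobi identity, the
  symmetry of second partial derivatives (\<open>partial_commute\<close>). That base point and covector
  components are legitimate smooth functions on the cotangent bundle is \<open>smooth_bundle_coords\<close>.
\<close>

section \<open>The algebra of smooth functions on Euclidean space\<close>

abbreviation RR :: "nat \<Rightarrow> (nat \<Rightarrow> real) set" where
  "RR n \<equiv> topspace (Euclidean_space n)"

abbreviation smooth :: "nat \<Rightarrow> ((nat \<Rightarrow> real) \<Rightarrow> real) \<Rightarrow> bool" where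
  "smooth n f \<equiv> smooth_on n (RR n) f"

lemma fun_upd_RR [simp]: "x \<in> RR n \<Longrightarrow> i < n \<Longrightarrow> x(i := s) \<in> RR n"
  by (auto simp: topspace_Euclidean_space)

lemma smooth_iff:
  "smooth n f \<longleftrightarrow> (\<forall>is. set is \<subseteq> {..<n} \<longrightarrow>
     continuous_on (RR n) (partials is f) \<and>
     (\<forall>x\<in>RR n. \<forall>i<n. (\<lambda>s. partials is f (x(i := s))) field_differentiable at (x i)))"
  by (simp add: smooth_on_def continuous_map_Euclidean_space_iff)

lemma smooth_continuous: "smooth n f \<Longrightarrow> continuous_on (RR n) f"
  unfolding smooth_iff by (elim allE[of _ "[]"]) simp

lemma smooth_field_differentiable:
  "smooth n f \<Longrightarrow> x \<in> RR n \<Longrightarrow> i < n \<Longrightarrow> (\<lambda>s. f (x(i := s))) field_differentiable at (x i)"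
  unfolding smooth_iff by (elim allE[of _ "[]"]) simp

lemma smooth_has_partial:
  assumes "smooth n f" "x \<in> RR n" "i < n"
  shows "((\<lambda>s. f (x(i := s))) has_real_derivative partial i f (x(i := u))) (at u)"
  using smooth_field_differentiable[OF assms(1), of "x(i := u)" i] assms
  by (simp add: partial_def DERIV_deriv_iff_field_differentiable)

lemma partials_append: "partials (is @ js) f = partials is (partials js f)"
  by (induction "is") auto

lemma smooth_partial:
  assumes "smooth n f" "i < n"
  shows "smooth n (partial i f)"
  unfolding smooth_iff
proof (intro allI impI)
  fix "is" assume "set is \<subseteq> {..<n}"
  then have "set (is @ [i]) \<subseteq> {..<n}"
    using assms by auto
  with assms(1) show "continuous_on (RR n) (partials is (partial i f)) \<and>
     (\<forall>x\<in>RR n. \<forall>j<n. (\<lambda>s. partials is (partial i f) (x(j := s))) field_differentiable at (x j))"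
    unfolding smooth_iff by (elim allE[of _ "is @ [i]"]) (simp add: partials_append)
qed

lemma partial_cong:
  assumes "\<And>x. x \<in> RR n \<Longrightarrow> f x = g x" "x \<in> RR n" "i < n"
  shows "partial i f x = partial i g x"
  using assms by (simp add: partial_def)

text \<open>
  Smoothness is the largest property that implies continuity and partial differentiability and
  is inherited by partial derivatives. Hence it can be proved for all members of a family at once,
  as soon as the family is closed under partial derivatives. The latter need only agree with a
  member on \<open>\<real>\<^sup>n\<close>, since the values of a function elsewhere do not matter.
\<close>

lemma smooth_coinduct:
  assumes "f \<in> S"
    and cont: "\<And>h. h \<in> S \<Longrightarrow> continuous_on (RR n) h"
    and diff: "\<And>h x i. h \<in> S \<Longrightarrow> x \<in> RR n \<Longrightarrow> i < n \<Longrightarrow>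
      (\<lambda>s. h (x(i := s))) field_differentiable at (x i)"
    and closed: "\<And>h i. h \<in> S \<Longrightarrow> i < n \<Longrightarrow> \<exists>k\<in>S. \<forall>x\<in>RR n. partial i h x = k x"
  shows "smooth n f"
  unfolding smooth_iff
proof (intro allI impI)
  fix "is" assume "set is \<subseteq> {..<n}"
  then have "\<exists>k\<in>S. \<forall>x\<in>RR n. partials is f x = k x"
  proof (induction "is")
    case Nil
    then show ?case using assms(1) by auto
  next
    case (Cons i "is")
    then obtain k where k: "k \<in> S" "\<forall>x\<in>RR n. partials is f x = k x" and i: "i < n"
      by auto
    then obtain l where "l \<in> S" "\<forall>x\<in>RR n. partial i k x = l x"
      using closed by blast
    moreover have "partials (i # is) f x = partial i k x" if "x \<in> RR n" for x
      using partial_cong[of n "partials is f" k x i] k i that by simp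
    ultimately show ?case by metis
  qed
  then obtain k where k: "k \<in> S" "\<forall>x\<in>RR n. partials is f x = k x"
    by blast
  have "continuous_on (RR n) (partials is f)"
    using cont[OF k(1)] k(2) by (simp cong: continuous_on_cong)
  moreover have "(\<lambda>s. partials is f (x(i := s))) field_differentiable at (x i)"
    if "x \<in> RR n" "i < n" for x i
  proof -
    have "(\<lambda>s. partials is f (x(i := s))) = (\<lambda>s. k (x(i := s)))"
      using k(2) that by auto
    then show ?thesis
      using diff[OF k(1) that] by simp
  qed
  ultimately show "continuous_on (RR n) (partials is f) \<and>
     (\<forall>x\<in>RR n. \<forall>i<n. (\<lambda>s. partials is f (x(i := s))) field_differentiable at (x i))"
    by blast
qed

lemma smooth_cong:
  assumes "\<And>x. x \<in> RR n \<Longrightarrow> f x = g x"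
  shows "smooth n f \<longleftrightarrow> smooth n g"
proof -
  have "smooth n g" if "smooth n f" "\<And>x. x \<in> RR n \<Longrightarrow> f x = g x" for f g
  proof (rule smooth_coinduct[of g "{h. \<exists>k. smooth n k \<and> (\<forall>x\<in>RR n. k x = h x)}"])
    fix h assume "h \<in> {h. \<exists>k. smooth n k \<and> (\<forall>x\<in>RR n. k x = h x)}"
    then obtain k where k: "smooth n k" "\<forall>x\<in>RR n. k x = h x"
      by blast
    show "continuous_on (RR n) h"
      using smooth_continuous[OF k(1)] k(2) by (simp cong: continuous_on_cong)
    show "(\<lambda>s. h (x(i := s))) field_differentiable at (x i)" if "x \<in> RR n" "i < n" for x i
      using smooth_field_differentiable[OF k(1) that] k(2) that by simp
    show "\<exists>l\<in>{h. \<exists>k. smooth n k \<and> (\<forall>x\<in>RR n. k x = h x)}. \<forall>x\<in>RR n. partial i h x = l x"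
      if "i < n" for i
      using smooth_partial[OF k(1) that] partial_cong[of n k h _ i] k(2) that by fastforce
  qed (use that in auto)
  then show ?thesis using assms by metis
qed

text \<open>
  Iterating the Leibniz rule on a product of smooth functions leads to ever longer sums of
  products. The closure of the smooth functions under both operations contains all of these, which
  makes it a family to which the preceding coinduction applies; this avoids any formula for
  iterated partial derivatives of a product.
\<close>

inductive_set generated :: "((nat \<Rightarrow> real) \<Rightarrow> real) set \<Rightarrow> ((nat \<Rightarrow> real) \<Rightarrow> real) set" for B where
  base: "f \<in> B \<Longrightarrow> f \<in> generated B"
| add: "f \<in> generated B \<Longrightarrow> g \<in> generated B \<Longrightarrow> (\<lambda>x. f x + g x) \<in> generated B"
| mult: "f \<in> generated B \<Longrightarrow> g \<in> generated B \<Longrightarrow> (\<lambda>x. f x * g x) \<in> generated B"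

lemma partial_add:
  assumes "(\<lambda>s. f (x(i := s))) field_differentiable at (x i)"
    "(\<lambda>s. g (x(i := s))) field_differentiable at (x i)"
  shows "partial i (\<lambda>x. f x + g x) x = partial i f x + partial i g x"
  using deriv_add[OF assms] by (simp add: partial_def)

lemma partial_mult:
  assumes "(\<lambda>s. f (x(i := s))) field_differentiable at (x i)"
    "(\<lambda>s. g (x(i := s))) field_differentiable at (x i)"
  shows "partial i (\<lambda>x. f x * g x) x = f x * partial i g x + partial i f x * g x"
  using deriv_mult[OF assms] by (simp add: partial_def)

lemma smooth_generated:
  assumes "f \<in> generated {h. smooth n h}"
  shows "smooth n f"
proof (rule smooth_coinduct[OF assms])
  fix h assume h: "h \<in> generated {h. smooth n h}"
  then show "continuous_on (RR n) h"
    by induction (auto intro: smooth_continuous continuous_intros)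
  have diff: "(\<lambda>s. h (x(i := s))) field_differentiable at (x i)"
    if "h \<in> generated {h. smooth n h}" "x \<in> RR n" "i < n" for h x i
    using that
    by induction (auto intro: smooth_field_differentiable field_differentiable_add field_differentiable_mult)
  show "(\<lambda>s. h (x(i := s))) field_differentiable at (x i)" if "x \<in> RR n" "i < n" for x i
    using diff h that by blast
  show "\<exists>k\<in>generated {h. smooth n h}. \<forall>x\<in>RR n. partial i h x = k x" if i: "i < n" for i
    using h
  proof induction
    case (base f)
    then show ?case using smooth_partial[of n f i] i by (auto intro: generated.base)
  next
    case (add f g)
    then obtain k l where "k \<in> generated {h. smooth n h}" "\<forall>x\<in>RR n. partial i f x = k x"
      "l \<in> generated {h. smooth n h}" "\<forall>x\<in>RR n. partial i g x = l x"
      by blast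
    then show ?case
      using i add.hyps
      by (intro bexI[of _ "\<lambda>x. k x + l x"]) (auto simp: partial_add diff intro: generated.add)
  next
    case (mult f g)
    then obtain k l where "k \<in> generated {h. smooth n h}" "\<forall>x\<in>RR n. partial i f x = k x"
      "l \<in> generated {h. smooth n h}" "\<forall>x\<in>RR n. partial i g x = l x"
      by blast
    then show ?case
      using i mult.hyps
      by (intro bexI[of _ "\<lambda>x. f x * l x + k x * g x"])
        (simp_all add: partial_mult diff generated.add generated.mult)
  qed
qed

lemma smooth_add: "smooth n f \<Longrightarrow> smooth n g \<Longrightarrow> smooth n (\<lambda>x. f x + g x)"
  by (rule smooth_generated) (simp add: generated.add generated.base)

lemma smooth_mult: "smooth n f \<Longrightarrow> smooth n g \<Longrightarrow> smooth n (\<lambda>x. f x * g x)"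
  by (rule smooth_generated) (simp add: generated.mult generated.base)

lemma partial_const [simp]: "partial i (\<lambda>x. c) = (\<lambda>x. 0)"
  by (simp add: partial_def fun_eq_iff)

lemma partial_coordinate: "partial i (\<lambda>x. x j) = (\<lambda>x. if i = j then 1 else 0)"
  by (auto simp: partial_def fun_eq_iff)

lemma smooth_const: "smooth n (\<lambda>x. c)"
  by (rule smooth_coinduct[of _ "range (\<lambda>c x. c)"]) (auto simp: fun_eq_iff)

lemma smooth_coordinate: "smooth n (\<lambda>x. x j)"
proof (rule smooth_coinduct[of _ "insert (\<lambda>x. x j) (range (\<lambda>c x. c))"])
  fix h :: "(nat \<Rightarrow> real) \<Rightarrow> real" assume h: "h \<in> insert (\<lambda>x. x j) (range (\<lambda>c x. c))"
  then show "continuous_on (RR n) h"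
    by (auto intro: continuous_on_subset[OF continuous_on_product_coordinates])
  show "(\<lambda>s. h (x(i := s))) field_differentiable at (x i)" for x i
    using h by (cases "i = j") auto
  show "\<exists>k\<in>insert (\<lambda>x. x j) (range (\<lambda>c x. c)). \<forall>x\<in>RR n. partial i h x = k x" for i
    using h by (auto simp: partial_coordinate)
qed auto

lemma smooth_cmult: "smooth n f \<Longrightarrow> smooth n (\<lambda>x. c * f x)"
  by (intro smooth_mult smooth_const)

lemma smooth_diff: "smooth n f \<Longrightarrow> smooth n g \<Longrightarrow> smooth n (\<lambda>x. f x - g x)"
  using smooth_add[OF _ smooth_cmult[of n g "-1"]] by simp

lemma smooth_partial_add:
  "smooth n f \<Longrightarrow> smooth n g \<Longrightarrow> x \<in> RR n \<Longrightarrow> i < n \<Longrightarrow>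
    partial i (\<lambda>x. f x + g x) x = partial i f x + partial i g x"
  by (intro partial_add smooth_field_differentiable)

lemma smooth_partial_mult:
  "smooth n f \<Longrightarrow> smooth n g \<Longrightarrow> x \<in> RR n \<Longrightarrow> i < n \<Longrightarrow>
    partial i (\<lambda>x. f x * g x) x = f x * partial i g x + partial i f x * g x"
  by (intro partial_mult smooth_field_differentiable)

lemma smooth_partial_diff:
  assumes "smooth n f" "smooth n g" "x \<in> RR n" "i < n"
  shows "partial i (\<lambda>x. f x - g x) x = partial i f x - partial i g x"
  using smooth_partial_add[OF assms(1) smooth_cmult[OF assms(2), of "-1"] assms(3,4)]
    smooth_partial_mult[OF smooth_const assms(2-4), of "-1"]
  by simp

section \<open>Symmetry of second partial derivatives\<close>

lemma continuous_on_two_coordinates: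
  "continuous_on UNIV (\<lambda>p::real \<times> real. x(i := fst p, j := snd p) :: nat \<Rightarrow> real)"
proof (rule continuous_on_coordinatewise_then_product)
  fix k
  show "continuous_on UNIV (\<lambda>p::real \<times> real. (x(i := fst p, j := snd p)) k)"
    by (cases "k = j"; cases "k = i") (auto intro: continuous_intros)
qed

text \<open>
  The mean value theorem, applied once in each direction, expresses the alternating sum over the
  corners of a square by the mixed derivative at some point of the square. The alternating sum is
  symmetric in the two directions, so that both mixed derivatives take a common value at (possibly
  different) points of an arbitrarily small square.
\<close>

lemma mixed_difference:
  fixes F Fx Fxy :: "real \<Rightarrow> real \<Rightarrow> real"
  assumes Fx: "\<And>s t. ((\<lambda>s. F s t) has_real_derivative Fx s t) (at s)"
    and Fxy: "\<And>s t. ((\<lambda>t. Fx s t) has_real_derivative Fxy s t) (at t)"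
    and "h > 0"
  obtains s t where "s \<in> {a..a + h}" "t \<in> {b..b + h}"
    "F (a + h) (b + h) - F (a + h) b - F a (b + h) + F a b = h * h * Fxy s t"
proof -
  have "((\<lambda>s. F s (b + h) - F s b) has_real_derivative Fx s (b + h) - Fx s b) (at s)" for s
    by (intro DERIV_diff Fx)
  then obtain s where s: "a < s" "s < a + h"
    "(F (a + h) (b + h) - F (a + h) b) - (F a (b + h) - F a b) = h * (Fx s (b + h) - Fx s b)"
    using MVT2[of a "a + h" "\<lambda>s. F s (b + h) - F s b" "\<lambda>s. Fx s (b + h) - Fx s b"] \<open>h > 0\<close>
    by auto
  obtain t where t: "b < t" "t < b + h" "Fx s (b + h) - Fx s b = h * Fxy s t"
    using MVT2[of b "b + h" "Fx s" "Fxy s"] Fxy \<open>h > 0\<close> by auto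
  show ?thesis
    by (rule that[of s t]) (use s t in \<open>auto simp: algebra_simps\<close>)
qed

lemma partial_commute:
  assumes f: "smooth n f" and x: "x \<in> RR n" and i: "i < n" and j: "j < n"
  shows "partial i (partial j f) x = partial j (partial i f) x"
proof (cases "i = j")
  case False
  define P where "P s t = x(i := s, j := t)" for s t
  define h where "h k = inverse (real (Suc k))" for k
  have P: "P s t \<in> RR n" for s t
    using x i j by (simp add: P_def)
  have Pi: "((\<lambda>s. g (P s t)) has_real_derivative partial i g (P s t)) (at s)"
    if "smooth n g" for g s t
    using smooth_has_partial[OF that, of "x(j := t)" i s] x i j False
    by (simp add: P_def fun_upd_twist)
  have Pj: "((\<lambda>t. g (P s t)) has_real_derivative partial j g (P s t)) (at t)"
    if "smooth n g" for g s t
    using smooth_has_partial[OF that, of "x(i := s)" j t] x i j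
    by (simp add: P_def)
  have h: "h k > 0" for k
    by (simp add: h_def)
  have "\<exists>s t. s \<in> {x i..x i + h k} \<and> t \<in> {x j..x j + h k} \<and>
      f (P (x i + h k) (x j + h k)) - f (P (x i + h k) (x j)) - f (P (x i) (x j + h k)) + f (P (x i) (x j))
      = h k * h k * partial j (partial i f) (P s t)" for k
    by (rule mixed_difference[of "\<lambda>s t. f (P s t)" "\<lambda>s t. partial i f (P s t)"
          "\<lambda>s t. partial j (partial i f) (P s t)" "h k" "x i" "x j"])
      (use Pi[OF f] Pj[OF smooth_partial[OF f i]] h in blast)+
  then obtain s t where st: "\<And>k. s k \<in> {x i..x i + h k}" "\<And>k. t k \<in> {x j..x j + h k}"
    "\<And>k. f (P (x i + h k) (x j + h k)) - f (P (x i + h k) (x j)) - f (P (x i) (x j + h k)) + f (P (x i) (x j))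
      = h k * h k * partial j (partial i f) (P (s k) (t k))"
    by metis
  have "\<exists>t s. t \<in> {x j..x j + h k} \<and> s \<in> {x i..x i + h k} \<and>
      f (P (x i + h k) (x j + h k)) - f (P (x i) (x j + h k)) - f (P (x i + h k) (x j)) + f (P (x i) (x j))
      = h k * h k * partial i (partial j f) (P s t)" for k
    by (rule mixed_difference[of "\<lambda>t s. f (P s t)" "\<lambda>t s. partial j f (P s t)"
          "\<lambda>t s. partial i (partial j f) (P s t)" "h k" "x j" "x i"])
      (use Pj[OF f] Pi[OF smooth_partial[OF f j]] h in blast)+
  then obtain t' s' where st': "\<And>k. s' k \<in> {x i..x i + h k}" "\<And>k. t' k \<in> {x j..x j + h k}"
    "\<And>k. f (P (x i + h k) (x j + h k)) - f (P (x i) (x j + h k)) - f (P (x i + h k) (x j)) + f (P (x i) (x j))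
      = h k * h k * partial i (partial j f) (P (s' k) (t' k))"
    by metis
  have "h k * h k * partial i (partial j f) (P (s' k) (t' k)) =
      h k * h k * partial j (partial i f) (P (s k) (t k))" for k
    unfolding st(3)[symmetric] st'(3)[symmetric] by simp
  then have eq: "partial i (partial j f) (P (s' k) (t' k)) = partial j (partial i f) (P (s k) (t k))" for k
    using h[of k] by (metis less_irrefl mult_cancel_left mult_eq_0_iff)
  have h0: "h \<longlonglongrightarrow> 0"
    unfolding h_def by (rule LIMSEQ_inverse_real_of_nat)
  have squeeze: "u \<longlonglongrightarrow> c" if "\<And>k. u k \<in> {c..c + h k}" for u c
    by (rule tendsto_sandwich[of "\<lambda>_. c" u _ "\<lambda>k. c + h k"])
      (use that tendsto_add[OF tendsto_const h0, of c] in auto)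
  have lim: "(\<lambda>k. g (P (u k) (v k))) \<longlonglongrightarrow> g x"
    if "smooth n g" "u \<longlonglongrightarrow> x i" "v \<longlonglongrightarrow> x j" for g u v
  proof -
    have "continuous_on UNIV (\<lambda>p. g (P (fst p) (snd p)))"
      unfolding P_def
      by (rule continuous_on_compose2[OF smooth_continuous[OF that(1)] continuous_on_two_coordinates])
        (use x i j in auto)
    from continuous_on_tendsto_compose[OF this tendsto_Pair[OF that(2,3)]]
    show ?thesis by (simp add: P_def)
  qed
  have "(\<lambda>k. partial i (partial j f) (P (s' k) (t' k))) \<longlonglongrightarrow> partial i (partial j f) x"
    by (intro lim smooth_partial f i j squeeze st')
  moreover have "(\<lambda>k. partial j (partial i f) (P (s k) (t k))) \<longlonglongrightarrow> partial j (partial i f) x"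
    by (intro lim smooth_partial f i j squeeze st)
  ultimately show ?thesis
    unfolding eq by (rule LIMSEQ_unique)
qed simp

section \<open>Euclidean space as a manifold\<close>

definition euclidean_manifold :: "nat \<Rightarrow> (nat \<Rightarrow> real) manifold" where
  "euclidean_manifold n =
    \<lparr>mdim = n, mtop = Euclidean_space n, matlas = {(RR n, id)}\<rparr>"

lemma euclidean_manifold_simps [simp]:
  "mdim (euclidean_manifold n) = n"
  "mtop (euclidean_manifold n) = Euclidean_space n"
  "matlas (euclidean_manifold n) = {(RR n, id)}"
  by (simp_all add: euclidean_manifold_def)

lemma inv_into_id [simp]: "x \<in> A \<Longrightarrow> inv_into A id x = x"
  using inv_into_f_f[of id A x] by simp

lemma second_countable_Euclidean_space: "second_countable (Euclidean_space n)"
proof -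
  obtain B :: "(nat \<Rightarrow> real) set set" where "countable B" "topological_basis B"
    using ex_countable_basis by blast
  then have "second_countable (euclidean :: (nat \<Rightarrow> real) topology)"
    unfolding second_countable_def
    by (metis open_openin topological_basisE topological_basis_open)
  then show ?thesis
    unfolding Euclidean_space_def euclidean_product_topology by (rule second_countable_subtopology)
qed

lemma smooth_manifold_euclidean: "smooth_manifold (euclidean_manifold n)"
proof -
  have "smooth n (\<lambda>x. inv_into (RR n) id x i)" for i
    using smooth_coordinate smooth_cong[of n "\<lambda>x. inv_into (RR n) id x i" "\<lambda>x. x i"] by simp
  then show ?thesis
    by (simp add: smooth_manifold_def Hausdorff_Euclidean_space second_countable_Euclidean_space)
qed

lemma smooth_functions_euclidean [simp]:
  "f \<in> smooth_functions (euclidean_manifold n) \<longleftrightarrow> smooth n f"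
  using smooth_cong[of n "\<lambda>x. f (inv_into (RR n) id x)" f]
  by (simp add: smooth_functions_def)

definition coord_basis :: "nat \<Rightarrow> nat \<Rightarrow> (nat \<Rightarrow> real) \<Rightarrow> (nat \<Rightarrow> real) tvec" where
  "coord_basis n = coord_tvec (euclidean_manifold n) (RR n, id)"

lemma coord_basis_smooth:
  "smooth n f \<Longrightarrow> p \<in> RR n \<Longrightarrow> i < n \<Longrightarrow> coord_basis n i p f = partial i f p"
  by (simp add: coord_basis_def coord_tvec_def partial_def)

lemma coord_basis_nonsmooth: "\<not> smooth n f \<Longrightarrow> coord_basis n i p f = 0"
  by (simp add: coord_basis_def coord_tvec_def)

lemma coord_basis_tangent:
  "p \<in> RR n \<Longrightarrow> i < n \<Longrightarrow> coord_basis n i p \<in> tangent_space (euclidean_manifold n) p"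
  by (simp add: tangent_space_def coord_basis_smooth coord_basis_nonsmooth smooth_add smooth_mult
      smooth_cmult smooth_partial_add smooth_partial_mult smooth_const)

lemma differential_coord_basis:
  "smooth n f \<Longrightarrow> p \<in> RR n \<Longrightarrow> i < n \<Longrightarrow>
    differential (euclidean_manifold n) f p (coord_basis n i p) = partial i f p"
  by (simp add: differential_def coord_basis_tangent coord_basis_smooth)

section \<open>Poisson structures on the plane\<close>

text \<open>
The bivector \<open>w \<partial>\<^sub>x \<and> \<partial>\<^sub>y\<close>.
\<close>

definition planar_bivector :: "((nat \<Rightarrow> real) \<Rightarrow> real) \<Rightarrow> (nat \<Rightarrow> real) bivector" where
  "planar_bivector w p \<alpha> \<beta> = w p *
    (\<alpha> (coord_basis 2 0 p) * \<beta> (coord_basis 2 1 p) - \<alpha> (coord_basis 2 1 p) * \<beta> (coord_basis 2 0 p))"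

definition planar_bracket ::
    "((nat \<Rightarrow> real) \<Rightarrow> real) \<Rightarrow> ((nat \<Rightarrow> real) \<Rightarrow> real) \<Rightarrow> ((nat \<Rightarrow> real) \<Rightarrow> real) \<Rightarrow> (nat \<Rightarrow> real) \<Rightarrow> real" where
  "planar_bracket w f g = (\<lambda>p. w p * (partial 0 f p * partial 1 g p - partial 1 f p * partial 0 g p))"

lemma poisson_bracket_planar:
  assumes "smooth 2 f" "smooth 2 g" "p \<in> RR 2"
  shows "poisson_bracket (euclidean_manifold 2) (planar_bivector w) f g p = planar_bracket w f g p"
  using assms
  by (simp add: poisson_bracket_def planar_bivector_def planar_bracket_def differential_coord_basis)

lemma smooth_planar_bracket:
  "smooth 2 w \<Longrightarrow> smooth 2 f \<Longrightarrow> smooth 2 g \<Longrightarrow> smooth 2 (planar_bracket w f g)"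
  unfolding planar_bracket_def by (intro smooth_mult smooth_diff smooth_partial) auto

lemma partial_planar_bracket:
  assumes "smooth 2 w" "smooth 2 f" "smooth 2 g" "p \<in> RR 2" "i < 2"
  shows "partial i (planar_bracket w f g) p =
    partial i w p * (partial 0 f p * partial 1 g p - partial 1 f p * partial 0 g p) +
    w p * (partial i (partial 0 f) p * partial 1 g p + partial 0 f p * partial i (partial 1 g) p
      - partial i (partial 1 f) p * partial 0 g p - partial 1 f p * partial i (partial 0 g) p)"
proof -
  have s: "smooth 2 (partial k f)" "smooth 2 (partial k g)" if "k < 2" for k
    using that assms smooth_partial by auto
  have D: "partial i (\<lambda>p. partial 0 f p * partial 1 g p - partial 1 f p * partial 0 g p) p =
      partial i (\<lambda>p. partial 0 f p * partial 1 g p) p - partial i (\<lambda>p. partial 1 f p * partial 0 g p) p"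
    by (intro smooth_partial_diff[of 2] smooth_mult s assms) auto
  have "partial i (planar_bracket w f g) p =
      w p * partial i (\<lambda>p. partial 0 f p * partial 1 g p - partial 1 f p * partial 0 g p) p +
      partial i w p * (partial 0 f p * partial 1 g p - partial 1 f p * partial 0 g p)"
    unfolding planar_bracket_def by (intro smooth_partial_mult[of 2] smooth_diff smooth_mult s assms) auto
  then show ?thesis
    unfolding D using s assms by (simp add: smooth_partial_mult[of 2] algebra_simps)
qed

text \<open>
  In dimension two the Jacobi identity imposes no condition on \<open>w\<close>: after expansion, all terms
  cancel in pairs because mixed partial derivatives commute.
\<close>

lemma planar_jacobi:
  assumes "smooth 2 w" "smooth 2 f" "smooth 2 g" "smooth 2 h" "p \<in> RR 2"
  shows "planar_bracket w f (planar_bracket w g h) p + planar_bracket w g (planar_bracket w h f) p +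
    planar_bracket w h (planar_bracket w f g) p = 0"
proof -
  have "partial (Suc 0) (partial 0 k) p = partial 0 (partial (Suc 0) k) p" if "smooth 2 k" for k
    using partial_commute[OF that assms(5), of 1 0] by simp
  note comm = this[OF assms(2)] this[OF assms(3)] this[OF assms(4)]
  have unfold: "planar_bracket w k l p = w p * (partial 0 k p * partial 1 l p - partial 1 k p * partial 0 l p)"
    for k l
    by (simp add: planar_bracket_def)
  show ?thesis
    unfolding unfold[of f "planar_bracket w g h"] unfold[of g "planar_bracket w h f"]
      unfold[of h "planar_bracket w f g"]
    using assms
    by (simp add: partial_planar_bracket comm) (simp add: algebra_simps)
qed

lemma poisson_manifold_planar:
  assumes w: "smooth 2 w"
  shows "poisson_manifold (euclidean_manifold 2) (planar_bivector w)"
proof -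
  let ?M = "euclidean_manifold 2" and ?\<pi> = "planar_bivector w"
  have smooth_br: "smooth 2 (poisson_bracket ?M ?\<pi> f g)" if "smooth 2 f" "smooth 2 g" for f g
    using smooth_cong[of 2 "poisson_bracket ?M ?\<pi> f g" "planar_bracket w f g"]
      poisson_bracket_planar[OF that] smooth_planar_bracket[OF w that] by simp
  have nested: "poisson_bracket ?M ?\<pi> f (poisson_bracket ?M ?\<pi> g h) p = planar_bracket w f (planar_bracket w g h) p"
    if "smooth 2 f" "smooth 2 g" "smooth 2 h" "p \<in> RR 2" for f g h p
  proof -
    have "partial i (poisson_bracket ?M ?\<pi> g h) p = partial i (planar_bracket w g h) p" if "i < 2" for i
      by (rule partial_cong[of 2]) (use that \<open>p \<in> RR 2\<close> poisson_bracket_planar \<open>smooth 2 g\<close> \<open>smooth 2 h\<close> in auto)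
    then show ?thesis
      using poisson_bracket_planar[OF that(1) smooth_br[OF that(2,3)] that(4), of w]
      by (simp add: planar_bracket_def[of w f])
  qed
  have "bivector_field ?M ?\<pi>"
    using smooth_br by (simp add: bivector_field_def planar_bivector_def algebra_simps)
  then show ?thesis
    by (simp add: poisson_manifold_def smooth_manifold_euclidean nested planar_jacobi[OF w])
qed

section \<open>Coordinates on the cotangent bundle of Euclidean space\<close>

lemma coord_basis_coordinate:
  "p \<in> RR n \<Longrightarrow> j < n \<Longrightarrow> coord_basis n j p (\<lambda>x. x i) = (if i = j then 1 else 0)"
  by (simp add: coord_basis_smooth smooth_coordinate partial_coordinate eq_commute)

lemma tangent_space_add:
  assumes "v \<in> tangent_space M p" "w \<in> tangent_space M p"
  shows "(\<lambda>f. v f + w f) \<in> tangent_space M p"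
  using assms by (simp add: tangent_space_def algebra_simps)

lemma tangent_space_scale:
  assumes "v \<in> tangent_space M p"
  shows "(\<lambda>f. r * v f) \<in> tangent_space M p"
  using assms by (simp add: tangent_space_def algebra_simps)

lemma differential_cotangent: "differential M f p \<in> cotangent_space M p"
  by (simp add: cotangent_space_def differential_def tangent_space_add tangent_space_scale)

lemma cotangent_space_sum:
  assumes "\<And>i. i \<in> I \<Longrightarrow> \<alpha> i \<in> cotangent_space M p"
  shows "(\<lambda>v. \<Sum>i\<in>I. c i * \<alpha> i v) \<in> cotangent_space M p"
  using assms
  by (auto simp: cotangent_space_def sum.distrib[symmetric] sum_distrib_left algebra_simps
      intro!: sum.cong sum.neutral)

definition bundle_coords :: "nat \<Rightarrow> (nat \<Rightarrow> real) \<times> (nat \<Rightarrow> real) covec \<Rightarrow> nat \<Rightarrow> real" where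
  "bundle_coords n = snd (cotangent_chart (euclidean_manifold n) (RR n, id))"

lemma bundle_coords_apply:
  "bundle_coords n (p, \<alpha>) i =
    (if i < n then p i else if i < 2 * n then \<alpha> (coord_basis n (i - n) p) else 0)"
  by (simp add: bundle_coords_def cotangent_chart_def coord_basis_def)

lemma cotangent_bundle_euclidean [simp]:
  "mdim (cotangent_bundle (euclidean_manifold n)) = 2 * n"
  "matlas (cotangent_bundle (euclidean_manifold n)) =
    {(cotangent_set (euclidean_manifold n) (RR n), bundle_coords n)}"
  by (simp_all add: cotangent_bundle_def bundle_coords_def cotangent_chart_def)

text \<open>
  The covector with prescribed components \<open>\<xi>\<^sub>i\<close> is \<open>\<Sum>\<^sub>i \<xi>\<^sub>i dx\<^sub>i\<close>. Surjectivity matters because a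
  function on the bundle is smooth only if its expression in the chart is differentiable along
  coordinate lines, and these lines must therefore stay inside the image of the chart.
\<close>

lemma bundle_coords_onto:
  assumes "z \<in> RR (2 * n)"
  shows "z \<in> bundle_coords n ` cotangent_set (euclidean_manifold n) (RR n)"
proof -
  define p where "p i = (if i < n then z i else 0)" for i
  define \<alpha> where "\<alpha> v = (\<Sum>i<n. z (n + i) * differential (euclidean_manifold n) (\<lambda>x. x i) p v)" for v
  have p: "p \<in> RR n"
    by (simp add: p_def topspace_Euclidean_space)
  have "\<alpha> \<in> cotangent_space (euclidean_manifold n) p"
    unfolding \<alpha>_def by (intro cotangent_space_sum differential_cotangent)
  with p have mem: "(p, \<alpha>) \<in> cotangent_set (euclidean_manifold n) (RR n)"
    by (simp add: cotangent_set_def)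
  have \<alpha>: "\<alpha> (coord_basis n j p) = z (n + j)" if "j < n" for j
    using p that
    by (simp add: \<alpha>_def differential_coord_basis smooth_coordinate partial_coordinate if_distrib
        sum.delta cong: if_cong)
  have "bundle_coords n (p, \<alpha>) i = z i" for i
  proof -
    consider "i < n" | "n \<le> i" "i < 2 * n" | "2 * n \<le> i"
      by linarith
    then show ?thesis
      using assms by cases (auto simp: bundle_coords_apply p_def \<alpha> topspace_Euclidean_space)
  qed
  then show ?thesis
    using mem by (metis ext imageI)
qed

lemma bundle_coords_into:
  "bundle_coords n ` cotangent_set (euclidean_manifold n) (RR n) \<subseteq> RR (2 * n)"
  by (auto simp: bundle_coords_apply cotangent_set_def topspace_Euclidean_space)

lemma bundle_coords_image:
  "bundle_coords n ` cotangent_set (euclidean_manifold n) (RR n) = RR (2 * n)"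
  using bundle_coords_into bundle_coords_onto by blast

lemma smooth_bundle_coords:
  "(\<lambda>b. bundle_coords n b i) \<in> smooth_functions (cotangent_bundle (euclidean_manifold n))"
proof -
  let ?C = "cotangent_set (euclidean_manifold n) (RR n)"
  have "smooth (2 * n) (\<lambda>z. bundle_coords n (inv_into ?C (bundle_coords n) z) i)"
    by (subst smooth_cong[of _ _ "\<lambda>z. z i"])
      (auto simp: bundle_coords_image f_inv_into_f smooth_coordinate)
  then show ?thesis
    by (simp add: smooth_functions_def bundle_coords_image)
qed

lemma smooth_map_into_bundleI:
  assumes "\<And>x. x \<in> RR m \<Longrightarrow> c x \<in> cotangent_set (euclidean_manifold n) (RR n)"
    and "\<And>i. i < 2 * n \<Longrightarrow> smooth m (\<lambda>x. bundle_coords n (c x) i)"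
  shows "smooth_map_into m (RR m) (cotangent_bundle (euclidean_manifold n)) c"
  using assms by (auto simp: smooth_map_into_def intro!: exI[of _ "RR m"])

lemma smooth_map_into_bundleE:
  assumes "smooth_map_into m V (cotangent_bundle (euclidean_manifold n)) c" "x \<in> V"
  obtains W where "openin (Euclidean_space m) W" "x \<in> W" "W \<subseteq> V"
    "c ` W \<subseteq> cotangent_set (euclidean_manifold n) (RR n)"
    "\<And>i. i < 2 * n \<Longrightarrow> smooth_on m W (\<lambda>y. bundle_coords n (c y) i)"
  using assms by (auto simp: smooth_map_into_def)

lemma smooth_map_into_bundle_mem:
  assumes "smooth_map_into m V (cotangent_bundle (euclidean_manifold n)) c" "x \<in> V"
  shows "c x \<in> cotangent_set (euclidean_manifold n) (RR n)"
  using assms by (auto simp: smooth_map_into_def)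

lemma smooth_map_into_bundle_diff:
  assumes "smooth_map_into m V (cotangent_bundle (euclidean_manifold n)) c" "x \<in> V"
    "i < 2 * n" "j < m"
  shows "(\<lambda>s. bundle_coords n (c (x(j := s))) i) field_differentiable at (x j)"
proof -
  obtain W where W: "x \<in> W" "smooth_on m W (\<lambda>y. bundle_coords n (c y) i)"
    using smooth_map_into_bundleE[OF assms(1,2)] assms(3) by metis
  then show ?thesis
    using assms(4) unfolding smooth_on_def by (elim conjE allE[of _ "[]"]) simp
qed

lemma cotangent_loop_diff:
  assumes "a \<in> cotangent_loops (euclidean_manifold n) \<pi>" "i < 2 * n"
  shows "(\<lambda>s. bundle_coords n (a s) i) field_differentiable at t"
proof -
  have "smooth_map_into 1 (RR 1) (cotangent_bundle (euclidean_manifold n)) (\<lambda>x. a (x 0))"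
    using assms by (simp add: cotangent_loops_def)
  from smooth_map_into_bundle_diff[OF this, of "(\<lambda>_. 0)(0 := t)" i 0] assms(2) show ?thesis
    by (simp add: topspace_Euclidean_space)
qed

lemma cotangent_loop_mem:
  assumes "a \<in> cotangent_loops (euclidean_manifold n) \<pi>"
  shows "a t \<in> cotangent_set (euclidean_manifold n) (RR n)"
proof -
  have "smooth_map_into 1 (RR 1) (cotangent_bundle (euclidean_manifold n)) (\<lambda>x. a (x 0))"
    using assms by (simp add: cotangent_loops_def)
  from smooth_map_into_bundle_mem[OF this, of "(\<lambda>_. 0)(0 := t)"] show ?thesis
    by (simp add: topspace_Euclidean_space)
qed

text \<open>
  A strict inequality that holds along the loop at \<open>\<epsilon> = 0\<close> persists for all small \<open>\<epsilon>\<close>,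
  uniformly on compact time intervals. The coordinate is continuous in \<open>(\<epsilon>, t)\<close> near each point
  of \<open>{0} \<times> K\<close>, and by the tube lemma the neighbourhoods on which it is positive contain a strip.
\<close>

lemma bundle_family_positive:
  assumes smooth: "smooth_map_into 2 {x \<in> RR 2. x 1 \<in> I} (cotangent_bundle (euclidean_manifold n))
      (\<lambda>x. c (x 1) (x 0))"
    and "0 \<in> I" "i < 2 * n"
    and pos: "\<And>t. bundle_coords n (c 0 t) i > 0"
    and "compact K"
  obtains X where "open X" "0 \<in> X"
    "\<And>\<epsilon> t. \<epsilon> \<in> X \<Longrightarrow> t \<in> K \<Longrightarrow> \<epsilon> \<in> I \<and> bundle_coords n (c \<epsilon> t) i > 0"
proof -
  let ?V = "{x \<in> RR 2. x 1 \<in> I}"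
  define P :: "real \<times> real \<Rightarrow> nat \<Rightarrow> real" where "P q = (\<lambda>_. 0)(1 := fst q, 0 := snd q)" for q
  define G where "G x = bundle_coords n (c (x 1) (x 0)) i" for x :: "nat \<Rightarrow> real"
  define W where "W = {q. fst q \<in> I \<and> G (P q) > 0}"
  have P_map: "continuous_map euclidean (Euclidean_space 2) P"
    unfolding Euclidean_space_def
    using continuous_on_two_coordinates[of "\<lambda>_. 0" 1 0]
    by (auto simp: P_def continuous_map_in_subtopology euclidean_product_topology)
  have "\<exists>N. open N \<and> (0, t) \<in> N \<and> N \<subseteq> W" for t
  proof -
    have "P (0, t) \<in> ?V"
      using \<open>0 \<in> I\<close> by (simp add: P_def topspace_Euclidean_space)
    with smooth obtain U where U: "openin (Euclidean_space 2) U" "P (0, t) \<in> U" "U \<subseteq> ?V"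
      and sm: "\<And>i. i < 2 * n \<Longrightarrow> smooth_on 2 U (\<lambda>x. bundle_coords n (c (x 1) (x 0)) i)"
      by (rule smooth_map_into_bundleE) (rule that)
    have "continuous_map (subtopology (Euclidean_space 2) U) euclideanreal G"
      using sm[OF \<open>i < 2 * n\<close>] unfolding smooth_on_def G_def[abs_def] by (elim allE[of _ "[]"]) simp
    then have "openin (subtopology (Euclidean_space 2) U)
        {x \<in> topspace (subtopology (Euclidean_space 2) U). G x \<in> {0<..}}"
      by (rule openin_continuous_map_preimage) simp
    then have "openin (Euclidean_space 2) {x \<in> topspace (subtopology (Euclidean_space 2) U). G x \<in> {0<..}}"
      using U(1) openin_trans_full by blast
    also have "{x \<in> topspace (subtopology (Euclidean_space 2) U). G x \<in> {0<..}} = {x \<in> U. G x > 0}"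
      using U(3) by auto
    finally have "openin euclidean {q \<in> topspace euclidean. P q \<in> {x \<in> U. G x > 0}}"
      by (rule openin_continuous_map_preimage[OF P_map])
    then have "open {q. P q \<in> U \<and> G (P q) > 0}"
      by simp
    moreover have "G (P (0, t)) > 0"
      using pos by (simp add: G_def P_def)
    moreover have "fst q \<in> I" if "P q \<in> U" for q
      using U(3) that by (auto simp: P_def)
    ultimately show ?thesis
      using U(2) by (intro exI[of _ "{q. P q \<in> U \<and> G (P q) > 0}"]) (auto simp: W_def)
  qed
  then obtain N where N: "\<And>t. open (N t)" "\<And>t. (0, t) \<in> N t" "\<And>t. N t \<subseteq> W"
    by metis
  have "\<exists>X. 0 \<in> X \<and> open X \<and> X \<times> K \<subseteq> (\<Union>t. N t)"
    by (rule Elementary_Topology.tube_lemma[OF \<open>compact K\<close>]) (use N in auto)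
  then obtain X where X: "0 \<in> X" "open X" "X \<times> K \<subseteq> (\<Union>t. N t)"
    by (elim exE conjE)
  have "(\<Union>t. N t) \<subseteq> W"
    using N(3) by (rule UN_least)
  with X(3) have XW: "X \<times> K \<subseteq> W"
    by (rule order_trans)
  show ?thesis
  proof (rule that[OF X(2,1)])
    fix \<epsilon> t assume "\<epsilon> \<in> X" "t \<in> K"
    with XW have "(\<epsilon>, t) \<in> W"
      by blast
    then show "\<epsilon> \<in> I \<and> bundle_coords n (c \<epsilon> t) i > 0"
      by (simp add: W_def G_def P_def)
  qed
qed

section \<open>Cotangent loops in the plane\<close>

lemma fst_eq_bundle_coords: "i < n \<Longrightarrow> bundle_coords n b i = fst b i"
  by (cases b) (simp add: bundle_coords_apply)

text \<open>
  With covector \<open>\<xi> dx + \<eta> dy\<close>, where \<open>\<eta>\<close> is the bundle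
  coordinate of index \<open>3\<close>, the vector \<open>\<pi>\<^sup>#(\<xi> dx + \<eta> dy)\<close> equals \<open>w (- \<eta> \<partial>\<^sub>x + \<xi> \<partial>\<^sub>y)\<close>.
\<close>

lemma cotangent_loop_planar:
  assumes "a \<in> cotangent_loops (euclidean_manifold 2) (planar_bivector w)"
  shows "((\<lambda>s. fst (a s) 0) has_real_derivative - w (fst (a t)) * bundle_coords 2 (a t) 3) (at t)"
proof -
  obtain p \<alpha> where a: "a t = (p, \<alpha>)" by force
  have p: "p \<in> RR 2"
    using cotangent_loop_mem[OF assms, of t] by (simp add: a cotangent_set_def)
  have "velocity (euclidean_manifold 2) (\<lambda>s. fst (a s)) t (\<lambda>x. x 0) =
      sharp (euclidean_manifold 2) (planar_bivector w) (a t) (\<lambda>x. x 0)"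
    using assms by (simp add: cotangent_loops_def)
  then have "deriv (\<lambda>s. fst (a s) 0) t = - w p * \<alpha> (coord_basis 2 1 p)"
    using p
    by (simp add: velocity_def sharp_def a planar_bivector_def smooth_coordinate
        differential_coord_basis partial_coordinate)
  moreover have "(\<lambda>s. fst (a s) 0) field_differentiable at t"
    using cotangent_loop_diff[OF assms, of 0 t] by (simp add: fst_eq_bundle_coords)
  ultimately show ?thesis
    by (simp add: DERIV_deriv_iff_field_differentiable[symmetric] a bundle_coords_apply)
qed

lemma periodic_nonincreasing_deriv:
  fixes f :: "real \<Rightarrow> real"
  assumes per: "\<And>s. f (s + 1) = f s"
    and deriv: "\<And>s. (f has_real_derivative f' s) (at s)"
    and le: "\<And>s. s \<in> {t - 1..t + 1} \<Longrightarrow> f' s \<le> 0"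
  shows "f' t = 0"
proof (rule DERIV_local_const[OF deriv, of 1])
  have mono: "f s \<le> f r" if "t - 1 \<le> r" "r \<le> s" "s \<le> t + 1" for r s
    by (rule DERIV_nonpos_imp_nonincreasing) (use that deriv le in force)+
  show "\<forall>s. \<bar>t - s\<bar> < 1 \<longrightarrow> f t = f s"
  proof (intro allI impI)
    fix s assume s: "\<bar>t - s\<bar> < 1"
    show "f t = f s"
    proof (cases "s \<le> t")
      case True
      then show ?thesis
        using mono[of "t - 1" s] mono[of s t] per[of "t - 1"] s by simp
    next
      case False
      then show ?thesis
        using mono[of t s] mono[of s "t + 1"] per[of t] s by simp
    qed
  qed
qed simp

text \<open>
  The covector is \<open>dy\<close> because its component \<open>\<eta> = 1\<close> is positive, which is what confines the
  loops near the constant one to the zeros of the bivector.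
\<close>

definition dy_at :: "(nat \<Rightarrow> real) \<Rightarrow> (nat \<Rightarrow> real) \<times> (nat \<Rightarrow> real) covec" where
  "dy_at p = (p, differential (euclidean_manifold 2) (\<lambda>x. x 1) p)"

lemma dy_at_mem: "p \<in> RR 2 \<Longrightarrow> dy_at p \<in> cotangent_set (euclidean_manifold 2) (RR 2)"
  by (simp add: dy_at_def cotangent_set_def differential_cotangent)

lemma bundle_coords_dy_at:
  assumes "p \<in> RR 2" "i < 4"
  shows "bundle_coords 2 (dy_at p) i = (if i < 2 then p i else if i = 3 then 1 else 0)"
proof -
  have "differential (euclidean_manifold 2) (\<lambda>x. x 1) p (coord_basis 2 j p) = (if j = 1 then 1 else 0)"
    if "j < 2" for j
    using assms that by (simp add: differential_coord_basis smooth_coordinate partial_coordinate)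
  from this[of "i - 2"] show ?thesis
    using assms(2) by (auto simp: bundle_coords_apply dy_at_def)
qed

text \<open>
  At a zero of \<open>w\<close> the map \<open>\<pi>\<^sup>#\<close> vanishes, so every constant path of covectors there is a loop.
\<close>

lemma constant_loop:
  assumes "p \<in> RR 2" "w p = 0"
  shows "(\<lambda>t. dy_at p) \<in> cotangent_loops (euclidean_manifold 2) (planar_bivector w)"
proof -
  have "smooth_map_into 1 (RR 1) (cotangent_bundle (euclidean_manifold 2)) (\<lambda>x. dy_at p)"
    by (intro smooth_map_into_bundleI dy_at_mem assms smooth_const)
  moreover have "velocity (euclidean_manifold 2) (\<lambda>s. p) t =
      sharp (euclidean_manifold 2) (planar_bivector w) (dy_at p)" for t
    using assms by (simp add: velocity_def sharp_def dy_at_def planar_bivector_def fun_eq_iff)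
  ultimately show ?thesis
    by (simp add: cotangent_loops_def dy_at_def)
qed

section \<open>The tangent cone at the origin\<close>

text \<open>
  The section obtained by moving the base point of the constant loop \<open>dy\<close> along the line through
  the origin with direction \<open>u\<close>.
\<close>

definition ray_section ::
    "(nat \<Rightarrow> real) \<Rightarrow> real \<Rightarrow> ((nat \<Rightarrow> real) \<times> (nat \<Rightarrow> real) covec) tvec" where
  "ray_section u =
    (\<lambda>t. velocity (cotangent_bundle (euclidean_manifold 2)) (\<lambda>\<epsilon>. dy_at (\<lambda>i. \<epsilon> * u i)) 0)"

lemma scale_RR: "u \<in> RR n \<Longrightarrow> (\<lambda>i. \<epsilon> * u i) \<in> RR n"
  by (simp add: topspace_Euclidean_space)

lemma ray_section_in_cone:
  assumes u: "u \<in> RR 2" and w: "\<And>\<epsilon>. w (\<lambda>i. \<epsilon> * u i) = 0"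
  shows "ray_section u \<in>
    tangent_cone (euclidean_manifold 2) (planar_bivector w) (\<lambda>t. dy_at (\<lambda>i. 0))"
proof -
  let ?M = "euclidean_manifold 2"
  have coords: "smooth 2 (\<lambda>x. bundle_coords 2 (dy_at (\<lambda>j. x 1 * u j)) i)" if "i < 4" for i
    using that smooth_mult[OF smooth_coordinate smooth_const, of 2 1 "u i"]
    by (cases "i < 2") (simp_all add: bundle_coords_dy_at scale_RR u smooth_const)
  have "smooth_map_into 2 (RR 2) (cotangent_bundle ?M) (\<lambda>x. dy_at (\<lambda>j. x 1 * u j))"
    by (rule smooth_map_into_bundleI) (use coords in \<open>simp_all add: dy_at_mem scale_RR u\<close>)
  moreover have "(\<lambda>t. dy_at (\<lambda>i. \<epsilon> * u i)) \<in> cotangent_loops ?M (planar_bivector w)" for \<epsilon>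
    by (intro constant_loop scale_RR u w)
  ultimately show ?thesis
    unfolding tangent_cone_def ray_section_def
    by (intro CollectI exI[of _ UNIV] exI[of _ "\<lambda>\<epsilon> t. dy_at (\<lambda>i. \<epsilon> * u i)"]) simp
qed

lemma ray_section_apply:
  assumes "u \<in> RR 2" "i < 2"
  shows "ray_section u t (\<lambda>b. bundle_coords 2 b i) = u i"
proof -
  have "((\<lambda>\<epsilon>. \<epsilon> * u i) has_real_derivative u i) (at 0)"
    by (auto intro!: derivative_eq_intros)
  then show ?thesis
    using assms
    by (simp add: ray_section_def velocity_def smooth_bundle_coords bundle_coords_dy_at scale_RR
        DERIV_imp_deriv)
qed

text \<open>
  The zero set is the union of the two coordinate axes, which is not a submanifold at the origin.
  The weight \<open>x y\<close> would have the same zero set; its square has a constant sign in addition, and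
  this makes \<open>x\<close> monotone along loops with \<open>\<eta> > 0\<close>.
\<close>

definition cross_weight :: "(nat \<Rightarrow> real) \<Rightarrow> real" where
  "cross_weight p = (p 0 * p 1) * (p 0 * p 1)"

lemma smooth_cross_weight: "smooth n cross_weight"
  unfolding cross_weight_def by (intro smooth_mult smooth_coordinate)

text \<open>
  Along the loop \<open>x' = - (x y)\<^sup>2 \<eta> \<le> 0\<close>. A periodic function that is monotone is constant,
  hence \<open>(x y)\<^sup>2 \<eta> = 0\<close>.
\<close>

lemma loop_on_cross:
  assumes a: "a \<in> cotangent_loops (euclidean_manifold 2) (planar_bivector cross_weight)"
    and pos: "\<And>s. s \<in> {t - 1..t + 1} \<Longrightarrow> bundle_coords 2 (a s) 3 > 0"
  shows "fst (a t) 0 * fst (a t) 1 = 0"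
proof -
  have "- cross_weight (fst (a t)) * bundle_coords 2 (a t) 3 = 0"
  proof (rule periodic_nonincreasing_deriv[OF _ cotangent_loop_planar[OF a]])
    show "fst (a (s + 1)) 0 = fst (a s) 0" for s
      using a by (simp add: cotangent_loops_def)
    show "- cross_weight (fst (a s)) * bundle_coords 2 (a s) 3 \<le> 0" if "s \<in> {t - 1..t + 1}" for s
      using pos[OF that] by (simp add: cross_weight_def)
  qed
  moreover have "bundle_coords 2 (a t) 3 > 0"
    by (rule pos) simp
  ultimately show ?thesis
    by (simp add: cross_weight_def)
qed

text \<open>
  For small \<open>\<epsilon>\<close> the loops of the family still have \<open>\<eta> > 0\<close>, so their base points satisfy \<open>x y = 0\<close>.
  Both coordinates vanish at \<open>\<epsilon> = 0\<close>, and dividing \<open>x y\<close> by \<open>\<epsilon>\<^sup>2\<close> shows that the product of their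
  derivatives in \<open>\<epsilon>\<close> vanishes as well.
\<close>

lemma cone_in_cross:
  assumes "\<sigma> \<in> tangent_cone (euclidean_manifold 2) (planar_bivector cross_weight)
      (\<lambda>t. dy_at (\<lambda>i. 0))"
  shows "\<sigma> t (\<lambda>b. bundle_coords 2 b 0) * \<sigma> t (\<lambda>b. bundle_coords 2 b 1) = 0"
proof -
  let ?M = "euclidean_manifold 2"
  obtain I c where "0 \<in> I"
    and loops: "\<And>\<epsilon>. \<epsilon> \<in> I \<Longrightarrow> c \<epsilon> \<in> cotangent_loops ?M (planar_bivector cross_weight)"
    and c0: "c 0 = (\<lambda>t. dy_at (\<lambda>i. 0))"
    and smooth: "smooth_map_into 2 {x \<in> RR 2. x 1 \<in> I} (cotangent_bundle ?M) (\<lambda>x. c (x 1) (x 0))"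
    and \<sigma>: "\<sigma> = (\<lambda>t. velocity (cotangent_bundle ?M) (\<lambda>\<epsilon>. c \<epsilon> t) 0)"
    using assms by (auto simp: tangent_cone_def)
  have zero: "(\<lambda>i. 0) \<in> RR 2"
    by (simp add: topspace_Euclidean_space)
  have pos: "bundle_coords 2 (c 0 s) 3 > 0" for s
    by (simp add: c0 bundle_coords_dy_at zero)
  obtain X where X: "open X" "0 \<in> X"
    and X_pos: "\<And>\<epsilon> s. \<epsilon> \<in> X \<Longrightarrow> s \<in> {t - 1..t + 1} \<Longrightarrow> \<epsilon> \<in> I \<and> bundle_coords 2 (c \<epsilon> s) 3 > 0"
    by (rule bundle_family_positive[OF smooth \<open>0 \<in> I\<close> _ pos, of "{t - 1..t + 1}"]) auto
  define f where "f i \<epsilon> = bundle_coords 2 (c \<epsilon> t) i" for i \<epsilon>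
  have f0: "f i 0 = 0" if "i < 2" for i
    using that by (simp add: f_def c0 bundle_coords_dy_at zero)
  have f_diff: "(f i has_real_derivative \<sigma> t (\<lambda>b. bundle_coords 2 b i)) (at 0)" if "i < 2" for i
  proof -
    have "(\<lambda>\<epsilon>. f i \<epsilon>) field_differentiable at 0"
      using smooth_map_into_bundle_diff[OF smooth, of "(\<lambda>_. 0)(0 := t)" i 1] that \<open>0 \<in> I\<close>
      by (simp add: f_def topspace_Euclidean_space)
    then show ?thesis
      by (simp add: \<sigma> velocity_def smooth_bundle_coords DERIV_deriv_iff_field_differentiable[symmetric]
          f_def[abs_def])
  qed
  have cross: "f 0 \<epsilon> * f 1 \<epsilon> = 0" if "\<epsilon> \<in> X" for \<epsilon>
    using loop_on_cross[OF loops, of \<epsilon> t] X_pos that by (force simp: f_def fst_eq_bundle_coords)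
  have quot: "((\<lambda>\<epsilon>. f i \<epsilon> / \<epsilon>) \<longlongrightarrow> \<sigma> t (\<lambda>b. bundle_coords 2 b i)) (at 0)" if "i < 2" for i
    using f_diff[OF that] f0[OF that] by (simp add: has_field_derivative_iff)
  have "((\<lambda>\<epsilon>. f 0 \<epsilon> / \<epsilon> * (f 1 \<epsilon> / \<epsilon>)) \<longlongrightarrow>
      \<sigma> t (\<lambda>b. bundle_coords 2 b 0) * \<sigma> t (\<lambda>b. bundle_coords 2 b 1)) (at 0)"
    by (intro tendsto_mult quot) auto
  moreover have "\<forall>\<^sub>F \<epsilon> in at 0. f 0 \<epsilon> / \<epsilon> * (f 1 \<epsilon> / \<epsilon>) = 0"
    using X cross by (auto simp: eventually_at_topological)
  then have "((\<lambda>\<epsilon>. f 0 \<epsilon> / \<epsilon> * (f 1 \<epsilon> / \<epsilon>)) \<longlongrightarrow> 0) (at 0)"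
    by (rule tendsto_eventually)
  ultimately show ?thesis
    using tendsto_unique[OF at_neq_bot] by blast
qed

lemma module_sections: "module (\<lambda>(r::real) \<sigma> (t::real) f. r * (\<sigma> t f :: real))"
  by unfold_locales (auto simp: plus_fun_def algebra_simps)

theorem mainTheorem3:
  shows "\<exists>(M :: (nat \<Rightarrow> real) manifold) \<pi> a.
    poisson_manifold M \<pi> \<and> a \<in> cotangent_loops M \<pi> \<and>
    \<not> is_vector_subspace (tangent_cone M \<pi> a)"
proof (intro exI conjI)
  let ?M = "euclidean_manifold 2" and ?\<pi> = "planar_bivector cross_weight"
  let ?a = "\<lambda>t::real. dy_at (\<lambda>i. 0)"
  show "poisson_manifold ?M ?\<pi>"
    by (intro poisson_manifold_planar smooth_cross_weight)
  show "?a \<in> cotangent_loops ?M ?\<pi>"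
    by (rule constant_loop) (simp_all add: topspace_Euclidean_space cross_weight_def)
  define e :: "nat \<Rightarrow> nat \<Rightarrow> real" where "e k = (\<lambda>i. if i = k then 1 else 0)" for k
  have e: "e k \<in> RR 2" if "k < 2" for k
    using that by (simp add: e_def topspace_Euclidean_space)
  have "ray_section (e k) \<in> tangent_cone ?M ?\<pi> ?a" if "k < 2" for k
    using that by (intro ray_section_in_cone e) (auto simp: cross_weight_def e_def)
  moreover have "ray_section (e 0) + ray_section (e 1) \<notin> tangent_cone ?M ?\<pi> ?a"
  proof
    assume "ray_section (e 0) + ray_section (e 1) \<in> tangent_cone ?M ?\<pi> ?a"
    from cone_in_cross[OF this, of 0] show False
      by (simp add: ray_section_apply e) (simp add: e_def)
  qed
  ultimately show "\<not> is_vector_subspace (tangent_cone ?M ?\<pi> ?a)"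
    by (auto simp: module.subspace_def[OF module_sections])
qed

end
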